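(* Let $\mathbb{K}$ be a field of characteristic not $2$ and let $n\geq 1$. Let $\mathcal{V}$ be a linear subspace of $M_n(\mathbb{K})$ such that every $M\in\mathcal{V}$ has at most one nonzero eigenvalue in $\mathbb{K}$ (i.e. $\#(\mathrm{Sp}_{\mathbb{K}}(M)\setminus\{0\})\leq 1$). Then $\dim\mathcal{V}\leq \binom{n}{2}+1$.
   Context: $\mathrm{Sp}_{\mathbb{K}}(M)$ denotes the set of eigenvalues of $M$ lying in $\mathbb{K}$. *)

theory Defs
  imports "Jordan_Normal_Form.VS_Connect" "Jordan_Normal_Form.Char_Poly"
begin

definition nonzero_spectrum :: "'a :: field mat \<Rightarrow> 'a set" where
  "nonzero_spectrum M = {k. eigenvalue M k \<and> k \<noteq> 0}"

end

theory Submission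
  imports Defs "HOL-Library.Function_Algebras"
begin

text \<open>
  Induction on the dimension of the space \<open>W\<close> acted upon, simultaneously for spaces \<open>V\<close> of
  operators with at most one nonzero eigenvalue and for those with none (where the bound is
  \<open>n choose 2\<close>).  In characteristic other than 2 there is a nonzero functional \<open>f\<close> on \<open>W\<close> such that
  \<open>V\<close> contains no operator \<open>w \<mapsto> f(w) y\<close> with \<open>y \<noteq> 0\<close> and \<open>f(y) = 0\<close>.  Put \<open>H = ker f\<close>; at most
  \<open>n - 1\<close> linear conditions cut out the subspace \<open>U\<close> of the operators in \<open>V\<close> that preserve \<open>H\<close>.
  If restriction to \<open>H\<close> is injective on \<open>V\<close>, the induction hypothesis applies to \<open>U\<close> on \<open>H\<close>.
  Otherwise \<open>V\<close> contains some \<open>E = f(\<cdot>) y\<close> with \<open>f(y) \<noteq> 0\<close>; then the operators in \<open>U\<close> with range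
  in \<open>H\<close>, which are cut out by one more condition and are determined by their restriction to \<open>H\<close>,
  have no nonzero eigenvalue on \<open>H\<close>: adding a multiple of \<open>E\<close> would create a second one.
\<close>

section \<open>Operators that preserve a subspace, and their nonzero eigenvalues there\<close>

locale operator_vector_space = vector_space scale
  for scale :: "'a::field \<Rightarrow> 'b::ab_group_add \<Rightarrow> 'b" (infixr \<open>*s\<close> 75)
begin

text \<open>The operators are linear on the whole type and merely preserve \<open>W\<close>, so that
  passing to a smaller subspace in the induction keeps the same functions instead of restricting
  them.\<close>

definition operator_space :: "'b set \<Rightarrow> ('b \<Rightarrow> 'b) set \<Rightarrow> bool" where
  "operator_space W V \<longleftrightarrow>
     (\<forall>M\<in>V. Vector_Spaces.linear scale scale M \<and> M ` W \<subseteq> W) \<and>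
     (\<forall>M\<in>V. \<forall>N\<in>V. (\<lambda>x. M x + N x) \<in> V) \<and>
     (\<forall>c. \<forall>M\<in>V. (\<lambda>x. c *s M x) \<in> V)"

definition nonzero_eigenvalues_on :: "'b set \<Rightarrow> ('b \<Rightarrow> 'b) \<Rightarrow> 'a set" where
  "nonzero_eigenvalues_on W M = {a. a \<noteq> 0 \<and> (\<exists>v\<in>W. v \<noteq> 0 \<and> M v = a *s v)}"

text \<open>Encodes that the restrictions to \<open>W\<close> of the operators in \<open>V\<close> form a space of dimension at
  most \<open>d\<close>: the functionals \<open>M \<mapsto> f (M h)\<close> embed it into the space of \<open>d\<close>-tuples of scalars.\<close>

definition separated_by :: "'b set \<Rightarrow> ('b \<Rightarrow> 'b) set \<Rightarrow> nat \<Rightarrow> bool" where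
  "separated_by W V d \<longleftrightarrow>
     (\<exists>\<Phi>. finite \<Phi> \<and> card \<Phi> \<le> d \<and>
        (\<forall>(f, h)\<in>\<Phi>. Vector_Spaces.linear scale (*) f) \<and>
        (\<forall>M\<in>V. (\<forall>(f, h)\<in>\<Phi>. f (M h) = 0) \<longrightarrow> (\<forall>w\<in>W. M w = 0)))"

definition square_zero_rank_one :: "'b set \<Rightarrow> ('b \<Rightarrow> 'b) set \<Rightarrow> ('b \<Rightarrow> 'a) \<Rightarrow> 'b \<Rightarrow> bool" where
  "square_zero_rank_one W V f y \<longleftrightarrow>
     Vector_Spaces.linear scale (*) f \<and> y \<in> W \<and> y \<noteq> 0 \<and> f y = 0 \<and>
     (\<exists>N\<in>V. \<forall>w\<in>W. N w = f w *s y)"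

lemma vector_space_pair_functional: "vector_space_pair scale ((*) :: 'a \<Rightarrow> 'a \<Rightarrow> 'a)"
  by unfold_locales (simp_all add: algebra_simps)

lemma functional_add: "Vector_Spaces.linear scale (*) f \<Longrightarrow> f (x + y) = f x + f y"
  and functional_diff: "Vector_Spaces.linear scale (*) f \<Longrightarrow> f (x - y) = f x - f y"
  and functional_scale: "Vector_Spaces.linear scale (*) f \<Longrightarrow> f (c *s x) = c * f x"
  and functional_zero: "Vector_Spaces.linear scale (*) f \<Longrightarrow> f 0 = 0"
  using vector_space_pair.linear_add[OF vector_space_pair_functional]
    vector_space_pair.linear_diff[OF vector_space_pair_functional]
    vector_space_pair.linear_scale[OF vector_space_pair_functional]
    vector_space_pair.linear_0[OF vector_space_pair_functional]
  by auto

lemma operator_add: "Vector_Spaces.linear scale scale f \<Longrightarrow> f (x + y) = f x + f y"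
  and operator_diff: "Vector_Spaces.linear scale scale f \<Longrightarrow> f (x - y) = f x - f y"
  and operator_scale: "Vector_Spaces.linear scale scale f \<Longrightarrow> f (c *s x) = c *s f x"
  and operator_zero: "Vector_Spaces.linear scale scale f \<Longrightarrow> f 0 = 0"
proof -
  interpret vector_space_pair scale scale by unfold_locales
  show "Vector_Spaces.linear scale scale f \<Longrightarrow> f (x + y) = f x + f y"
    "Vector_Spaces.linear scale scale f \<Longrightarrow> f (x - y) = f x - f y"
    "Vector_Spaces.linear scale scale f \<Longrightarrow> f (c *s x) = c *s f x"
    "Vector_Spaces.linear scale scale f \<Longrightarrow> f 0 = 0"
    by (auto simp: linear_add linear_diff linear_scale linear_0)
qed

section \<open>Functionals without square-zero operators of rank one\<close>

lemma exists_functional_one_on_independent: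
  assumes "independent B"
  obtains f where "Vector_Spaces.linear scale (*) f" "\<And>b. b \<in> B \<Longrightarrow> f b = 1"
  using vector_space_pair.linear_independent_extend[OF vector_space_pair_functional assms, of "\<lambda>_. 1"]
  by auto

text \<open>If both pairings were nonzero, suitable multiples of the two operators would add up to an
  operator swapping \<open>y\<close> and \<open>y'\<close>, which has the eigenvalues \<open>1\<close> and \<open>-1\<close>.\<close>

lemma square_zero_rank_one_pairing:
  assumes two: "(2 :: 'a) \<noteq> 0"
    and W: "subspace W" and V: "operator_space W V"
    and spec: "\<forall>M\<in>V. \<forall>a\<in>nonzero_eigenvalues_on W M. \<forall>b\<in>nonzero_eigenvalues_on W M. a = b"
    and y: "square_zero_rank_one W V f y" and y': "square_zero_rank_one W V f' y'"
    and nz: "f' y \<noteq> 0"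
  shows "f y' = 0"
proof (rule ccontr)
  assume nz': "f y' \<noteq> 0"
  obtain N where N: "N \<in> V" "\<And>w. w \<in> W \<Longrightarrow> N w = f w *s y"
    using y unfolding square_zero_rank_one_def by blast
  obtain N' where N': "N' \<in> V" "\<And>w. w \<in> W \<Longrightarrow> N' w = f' w *s y'"
    using y' unfolding square_zero_rank_one_def by blast
  note yd = y[unfolded square_zero_rank_one_def] and yd' = y'[unfolded square_zero_rank_one_def]
  define M where "M = (\<lambda>x. inverse (f y') *s N x + inverse (f' y) *s N' x)"
  have lin: "Vector_Spaces.linear scale scale M" and M: "M \<in> V"
    using V N(1) N'(1) unfolding operator_space_def M_def by auto
  have My: "M y = y'" and My': "M y' = y"
    using yd yd' nz nz' by (simp_all add: M_def N N')
  have "1 \<in> nonzero_eigenvalues_on W M"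
  proof -
    have "y + y' \<noteq> 0"
    proof
      assume "y + y' = 0"
      then have "f (y + y') = 0" using yd functional_zero by auto
      then show False using yd nz' by (simp add: functional_add)
    qed
    moreover have "M (y + y') = 1 *s (y + y')"
      using operator_add[OF lin] My My' by (simp add: add.commute)
    moreover have "y + y' \<in> W" using W yd yd' subspace_add by auto
    ultimately show ?thesis unfolding nonzero_eigenvalues_on_def by force
  qed
  moreover have "- 1 \<in> nonzero_eigenvalues_on W M"
  proof -
    have "y - y' \<noteq> 0" using yd nz' by auto
    moreover have "M (y - y') = (- 1) *s (y - y')"
      using operator_diff[OF lin] My My' by simp
    moreover have "y - y' \<in> W" using W yd yd' subspace_diff by auto
    ultimately show ?thesis unfolding nonzero_eigenvalues_on_def by force
  qed
  ultimately have "1 = (- 1 :: 'a)" using spec M by blast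
  then have "(1 :: 'a) + 1 = 0" using add.right_inverse[of "1::'a"] by metis
  then show False using two by simp
qed

lemma exists_functional_without_square_zero_rank_one:
  assumes two: "(2 :: 'a) \<noteq> 0"
    and B: "finite B" and W: "W = span B" and V: "operator_space W V"
    and spec: "\<forall>M\<in>V. \<forall>a\<in>nonzero_eigenvalues_on W M. \<forall>b\<in>nonzero_eigenvalues_on W M. a = b"
    and w0: "w0 \<in> W" "w0 \<noteq> 0"
  shows "\<exists>f w. Vector_Spaces.linear scale (*) f \<and> w \<in> W \<and> f w = 1 \<and>
    (\<forall>y. \<not> square_zero_rank_one W V f y)"
proof (rule ccontr)
  assume neg: "\<not> ?thesis"
  have ex: "\<exists>y. square_zero_rank_one W V f y"
    if "Vector_Spaces.linear scale (*) f" "w \<in> W" "f w = 1" for f w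
    using that neg by blast
  have subW: "subspace W" using W by simp
  txt \<open>A chain of pairs \<open>(f\<^sub>i, y\<^sub>i)\<close> with \<open>f\<^sub>i(y\<^sub>j) = 1\<close> for \<open>j < i\<close> and \<open>f\<^sub>i(y\<^sub>j) = 0\<close> for
    \<open>j \<ge> i\<close> can be prolonged indefinitely, since the \<open>y\<^sub>i\<close> are independent.\<close>
  define chain where "chain Y L \<longleftrightarrow> Y \<subseteq> W \<and> independent Y \<and>
      (\<forall>f\<in>L. \<exists>y\<in>Y. square_zero_rank_one W V f y) \<and>
      (\<forall>s z. Vector_Spaces.linear scale (*) s \<longrightarrow> (\<forall>y\<in>Y. s y = 1) \<longrightarrow> z \<in> span Y \<longrightarrow>
         s z = 0 \<longrightarrow> (\<forall>f\<in>L. f z = 0) \<longrightarrow> z = 0)" for Y L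
  have "\<exists>Y L. finite Y \<and> card Y = k \<and> chain Y L" for k
  proof (induction k)
    case 0
    show ?case
      by (rule exI[of _ "{}"], rule exI[of _ "{}"]) (auto simp: chain_def dependent_def)
  next
    case (Suc k)
    then obtain Y L where Y0: "finite Y" "card Y = k" and YL: "chain Y L" by blast
    have Y: "Y \<subseteq> W" "independent Y" using YL by (simp_all add: chain_def)
    have L: "\<And>f. f \<in> L \<Longrightarrow> \<exists>y\<in>Y. square_zero_rank_one W V f y"
      and sep: "\<And>s z. Vector_Spaces.linear scale (*) s \<Longrightarrow> \<forall>y\<in>Y. s y = 1 \<Longrightarrow> z \<in> span Y \<Longrightarrow>
         s z = 0 \<Longrightarrow> \<forall>f\<in>L. f z = 0 \<Longrightarrow> z = 0"
      using YL unfolding chain_def by blast+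
    \<comment> \<open>For empty \<open>Y\<close> the vector \<open>w0\<close> takes its place: in
      either case \<open>g\<close> has the value 1 at some vector of \<open>W\<close>, as
      \<open>ex\<close> requires.\<close>
    define T where "T = (if Y = {} then {w0} else Y)"
    have "independent T" using Y(2) w0 by (simp add: T_def)
    then obtain g where g: "Vector_Spaces.linear scale (*) g" "\<And>t. t \<in> T \<Longrightarrow> g t = 1"
      by (rule exists_functional_one_on_independent) blast
    have "Y \<subseteq> T" by (auto simp: T_def)
    then have gY: "\<forall>y\<in>Y. g y = 1" using g(2) by blast
    obtain t where "t \<in> T" "t \<in> W" using Y(1) w0 by (cases "Y = {}") (auto simp: T_def)
    then obtain u where u: "square_zero_rank_one W V g u" using ex[OF g(1)] g(2) by blast
    note ud = u[unfolded square_zero_rank_one_def]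
    \<comment> \<open>Each \<open>f\<close> in \<open>L\<close> belongs to some \<open>y\<close> in
      \<open>Y\<close>, and \<open>g y = 1\<close>; as this pairing is nonzero, the opposite pairing
      \<open>f u\<close> must vanish.\<close>
    have Lu: "f u = 0" if f: "f \<in> L" for f
    proof -
      obtain y where y: "y \<in> Y" "square_zero_rank_one W V f y" using L[OF f] by blast
      then show ?thesis
        using square_zero_rank_one_pairing[OF two subW V spec y(2) u] gY by simp
    qed
    \<comment> \<open>Here \<open>g\<close> itself serves as the functional \<open>s\<close>:
      \<open>u\<close> is killed by \<open>g\<close> and by all of \<open>L\<close>, so inside
      \<open>span Y\<close> it would be zero.\<close>
    have uY: "u \<notin> span Y" using sep[OF g(1) gY, of u] ud Lu by blast
    have "chain (insert u Y) (insert g L)"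
      unfolding chain_def
    proof (intro conjI allI impI ballI)
      show "insert u Y \<subseteq> W" using Y ud by auto
      show "independent (insert u Y)" using uY Y by (simp add: independent_insertI)
      show "\<exists>y\<in>insert u Y. square_zero_rank_one W V f y" if "f \<in> insert g L" for f
        using that L u by auto
      fix s z assume s: "Vector_Spaces.linear scale (*) s" "\<forall>y\<in>insert u Y. s y = 1"
        and z: "z \<in> span (insert u Y)" "s z = 0" "\<forall>f\<in>insert g L. f z = 0"
      \<comment> \<open>The old condition, again with \<open>g\<close> for \<open>s\<close>, gives
        \<open>z = c *s u\<close>; the new functional \<open>s\<close> is 1 at \<open>u\<close>,
        which forces \<open>c = 0\<close>.\<close>
      obtain c where c: "z - c *s u \<in> span Y" using z(1) span_breakdown_eq by blast
      have "g (z - c *s u) = 0" using g(1) z(3) ud by (simp add: functional_diff functional_scale)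
      moreover have "f (z - c *s u) = 0" if f: "f \<in> L" for f
      proof -
        have "Vector_Spaces.linear scale (*) f"
          using L[OF f] unfolding square_zero_rank_one_def by blast
        then show ?thesis using f z(3) Lu[OF f] by (simp add: functional_diff functional_scale)
      qed
      ultimately have "z - c *s u = 0" using sep[OF g(1) gY c] by blast
      then have zc: "z = c *s u" by simp
      then have "c = 0" using z(2) s by (simp add: functional_scale)
      then show "z = 0" using zc by simp
    qed
    moreover have "u \<notin> Y" using uY span_base by blast
    then have "finite (insert u Y)" "card (insert u Y) = Suc k" using Y0 by simp_all
    ultimately show ?case by blast
  qed
  then obtain Y L where Y: "card Y = Suc (card B)" "chain Y L" by blast
  then have "independent Y" "Y \<subseteq> span B" by (simp_all add: chain_def W)
  then have "finite Y \<and> card Y \<le> card B" by (rule independent_span_bound[OF B])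
  then show False using Y by simp
qed

section \<open>Hyperplanes and the counting of linear conditions\<close>

text \<open>\<open>B\<close> is only a spanning set; the cardinality drops because
  \<open>insert w C\<close> is an independent subset of \<open>span B\<close>.\<close>

lemma hyperplane_basis:
  assumes B: "finite B" and W: "W = span B"
    and f: "Vector_Spaces.linear scale (*) f" and w: "w \<in> W" "f w \<noteq> 0"
  obtains C where "finite C" "card C < card B" "independent (insert w C)" "w \<notin> C"
    "span C = {x \<in> W. f x = 0}"
proof -
  define H where "H = {x \<in> W. f x = 0}"
  have subW: "subspace W" using W by simp
  have H: "subspace H"
    by (intro subspaceI)
      (auto simp: H_def functional_add[OF f] functional_scale[OF f] functional_zero[OF f]
        intro: subspace_0[OF subW] subspace_add[OF subW] subspace_scale[OF subW])
  obtain C where C: "C \<subseteq> H" "independent C" "H \<subseteq> span C" "card C = dim H"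
    by (rule basis_exists)
  have spC: "span C = H" using C H span_subspace by blast
  have wC: "w \<notin> span C" using w spC by (simp add: H_def)
  have ind: "independent (insert w C)" using wC C independent_insertI by blast
  moreover have "insert w C \<subseteq> span B" using C w W by (auto simp: H_def)
  ultimately have "finite (insert w C) \<and> card (insert w C) \<le> card B"
    by (rule independent_span_bound[OF B])
  moreover have notin: "w \<notin> C" using wC span_base by blast
  ultimately have "finite C" "card C < card B" by auto
  then show thesis by (rule that[OF _ _ ind notin spC[unfolded H_def]])
qed

text \<open>Modulo \<open>span C\<close> the operator acts as the scalar \<open>t\<close>. So
  \<open>M - t\<close> maps the span of \<open>insert w C\<close> into the smaller space
  \<open>span C\<close> and has a nonzero kernel vector, which is an eigenvector.\<close>

lemma eigenvalue_on_quotient_line: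
  assumes C: "finite C" "independent (insert w C)" "w \<notin> C" "span C \<subseteq> W" "w \<in> W" "subspace W"
    and M: "Vector_Spaces.linear scale scale M"
    and im: "\<And>x. x \<in> W \<Longrightarrow> M x - t *s x \<in> span C" and t: "t \<noteq> 0"
  shows "t \<in> nonzero_eigenvalues_on W M"
proof (rule ccontr)
  assume no: "t \<notin> nonzero_eigenvalues_on W M"
  interpret p: vector_space_pair scale scale by unfold_locales
  let ?N = "\<lambda>x. M x - t *s x"
  have N: "Vector_Spaces.linear scale scale ?N"
    by (rule p.linear_compose_sub[OF M]) simp
  have sub: "span (insert w C) \<subseteq> W"
    using C span_base by (intro span_minimal) auto
  have inj: "inj_on ?N (span (insert w C))"
    unfolding p.linear_inj_on_iff_eq_0[OF N subspace_span]
    using no t sub unfolding nonzero_eigenvalues_on_def by auto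
  have "independent (?N ` insert w C)"
    by (rule p.linear_independent_injective_image[OF N C(2) inj])
  moreover have "?N ` insert w C \<subseteq> span C" using im C(4,5) span_base by auto
  ultimately have "card (?N ` insert w C) \<le> card C"
    using independent_span_bound[OF C(1)] by blast
  moreover have "card (?N ` insert w C) = card (insert w C)"
    using inj inj_on_subset span_superset by (intro card_image) blast
  ultimately show False using C by simp
qed

text \<open>Dimension count: imposing \<open>f (M c) = 0\<close> for the at most \<open>n\<close>
  elements of \<open>C\<close> leads into \<open>U\<close>, where the given pairs detect whether
  \<open>M\<close> vanishes on \<open>H\<close>, hence on \<open>W\<close>. The new separating
  family consists of the old one and the pairs \<open>(f, c)\<close>.\<close>

lemma separated_by_extend:
  assumes C: "finite C" "card C \<le> n" and f: "Vector_Spaces.linear scale (*) f"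
    and U: "separated_by H U d" "d + n \<le> d'"
    and V: "\<And>M. M \<in> V \<Longrightarrow> \<forall>c\<in>C. f (M c) = 0 \<Longrightarrow> M \<in> U"
    and zero: "\<And>M. M \<in> V \<Longrightarrow> M \<in> U \<Longrightarrow> \<forall>h\<in>H. M h = 0 \<Longrightarrow> \<forall>w\<in>W. M w = 0"
  shows "separated_by W V d'"
proof -
  obtain \<Phi> where \<Phi>: "finite \<Phi>" "card \<Phi> \<le> d" "\<forall>(f, h)\<in>\<Phi>. Vector_Spaces.linear scale (*) f"
    "\<forall>M\<in>U. (\<forall>(f, h)\<in>\<Phi>. f (M h) = 0) \<longrightarrow> (\<forall>w\<in>H. M w = 0)"
    using U(1) unfolding separated_by_def by blast
  let ?\<Psi> = "\<Phi> \<union> Pair f ` C"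
  have "card ?\<Psi> \<le> card \<Phi> + card (Pair f ` C)" by (rule card_Un_le)
  also have "card (Pair f ` C) \<le> card C" using C(1) by (rule card_image_le)
  finally have card: "card ?\<Psi> \<le> d'" using \<Phi>(2) C(2) U(2) by linarith
  show ?thesis unfolding separated_by_def
  proof (intro exI[of _ ?\<Psi>] conjI ballI impI)
    show "finite ?\<Psi>" "card ?\<Psi> \<le> d'" using \<Phi>(1) C(1) card by auto
    show "case p of (g, h) \<Rightarrow> Vector_Spaces.linear scale (*) g" if "p \<in> ?\<Psi>" for p
      using that \<Phi>(3) f by auto
    fix M w assume M: "M \<in> V" "\<forall>(g, h)\<in>?\<Psi>. g (M h) = 0" and w: "w \<in> W"
    have "M \<in> U" using V[OF M(1)] M(2) by auto
    then show "M w = 0" using \<Phi>(4) M zero w by blast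
  qed
qed

section \<open>Induction on the dimension\<close>

text \<open>\<open>e\<close> varies in the induction, since the case \<open>e = 1\<close> may call
  the hypothesis with \<open>e = 0\<close>. The size of \<open>B\<close> is only bounded, because
  \<open>hyperplane_basis\<close> yields just \<open>card C < card B\<close>.\<close>

theorem few_eigenvalues_separated_by:
  assumes two: "(2 :: 'a) \<noteq> 0"
  shows "e \<le> 1 \<Longrightarrow> finite B \<Longrightarrow> card B \<le> n \<Longrightarrow> operator_space (span B) V \<Longrightarrow>
    (\<And>M. M \<in> V \<Longrightarrow> finite (nonzero_eigenvalues_on (span B) M) \<and>
      card (nonzero_eigenvalues_on (span B) M) \<le> e) \<Longrightarrow>
    separated_by (span B) V ((n choose 2) + e)"
proof (induction n arbitrary: e B V)
  case 0
  then have "span B = {0}" by simp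
  moreover have "M 0 = 0" if "M \<in> V" for M
    using 0(4) that operator_zero unfolding operator_space_def by blast
  ultimately show ?case unfolding separated_by_def by (intro exI[of _ "{}"]) auto
next
  case (Suc n)
  define W where "W = span B"
  have V: "operator_space W V" using Suc.prems(4) by (simp add: W_def)
  have addV: "(\<lambda>x. M x + N x) \<in> V" if "M \<in> V" "N \<in> V" for M N
    using V that unfolding operator_space_def by blast
  have subW: "subspace W" by (simp add: W_def)
  have lin: "Vector_Spaces.linear scale scale M" and inv: "x \<in> W \<Longrightarrow> M x \<in> W" if "M \<in> V" for M x
    using V that unfolding operator_space_def by auto
  have spec: "\<forall>M\<in>V. \<forall>a\<in>nonzero_eigenvalues_on W M. \<forall>b\<in>nonzero_eigenvalues_on W M. a = b"
  proof
    fix M assume "M \<in> V"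
    then have "finite (nonzero_eigenvalues_on W M)" "card (nonzero_eigenvalues_on W M) \<le> Suc 0"
      using Suc.prems(1) Suc.prems(5)[of M] unfolding W_def by auto
    then show "\<forall>a\<in>nonzero_eigenvalues_on W M. \<forall>b\<in>nonzero_eigenvalues_on W M. a = b"
      using card_le_Suc0_iff_eq by blast
  qed
  \<comment> \<open>The summand \<open>n\<close> pays for the conditions \<open>f (M c) = 0\<close>
    on a basis of the hyperplane.\<close>
  have choose: "Suc n choose 2 = n + (n choose 2)"
    using binomial_Suc_Suc[of n 1] by (simp add: numeral_2_eq_2)
  show ?case
  proof (cases "W = {0}")
    case True
    then show ?thesis using lin operator_zero unfolding separated_by_def W_def[symmetric]
      by (intro exI[of _ "{}"]) auto
  next
    case False
    then obtain w0 where "w0 \<in> W" "w0 \<noteq> 0" using subW subspace_0 by blast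
    then obtain f w where f: "Vector_Spaces.linear scale (*) f" and w: "w \<in> W" "f w = 1"
      and good: "\<And>y. \<not> square_zero_rank_one W V f y"
      using exists_functional_without_square_zero_rank_one[OF two Suc.prems(2) W_def V spec]
      by blast
    obtain C where C: "finite C" "card C < card B" "independent (insert w C)" "w \<notin> C"
      and H: "span C = {x \<in> W. f x = 0}"
      using hyperplane_basis[OF Suc.prems(2) W_def f w(1)] w(2) by auto
    have card: "card C \<le> n" using C(2) Suc.prems(3) by simp
    \<comment> \<open>By linearity, vanishing of \<open>f (M c)\<close> on the basis
      \<open>C\<close> means that \<open>M\<close> maps the hyperplane \<open>span C\<close> to
      itself.\<close>
    define U where "U = {M \<in> V. \<forall>c\<in>C. f (M c) = 0}"
    have inv_H: "M x \<in> span C" if M: "M \<in> U" and x: "x \<in> span C" for M x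
    proof -
      have "span C \<subseteq> {x. f (M x) = 0}"
        using M lin f by (intro span_minimal subspaceI)
          (auto simp: U_def operator_add operator_scale operator_zero functional_add
            functional_scale functional_zero)
      moreover have "M x \<in> W" using inv M x H by (auto simp: U_def)
      ultimately show ?thesis using x H by auto
    qed
    have decomp: "M x = f x *s M w" if M: "M \<in> V" "\<forall>h\<in>span C. M h = 0" and x: "x \<in> W" for M x
    proof -
      have "x - f x *s w \<in> W" using x w subW subspace_diff subspace_scale by blast
      then have "x - f x *s w \<in> span C"
        using H f w by (simp add: functional_diff functional_scale)
      then have "M (x - f x *s w) = 0" using M(2) by blast
      then show ?thesis using lin[OF M(1)] by (simp add: operator_diff operator_scale)
    qed
    \<comment> \<open>On \<open>W\<close> such an operator is \<open>f\<close> times the vector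
      \<open>M w\<close>; were \<open>f (M w)\<close> zero, it would be of the kind that the choice
      of \<open>f\<close> excludes.\<close>
    have vanish: "f (M w) \<noteq> 0" if M: "M \<in> V" "\<forall>h\<in>span C. M h = 0" and x: "x \<in> W" "M x \<noteq> 0" for M x
    proof
      assume "f (M w) = 0"
      moreover have "M w \<noteq> 0" using decomp[OF M x(1)] x(2) by auto
      ultimately have "square_zero_rank_one W V f (M w)"
        unfolding square_zero_rank_one_def using f inv[OF M(1) w(1)] decomp[OF M] M(1) by blast
      then show False using good by blast
    qed
    have opU: "operator_space (span C) U"
      unfolding operator_space_def
    proof (intro conjI ballI allI)
      show "Vector_Spaces.linear scale scale M" "M ` span C \<subseteq> span C" if "M \<in> U" for M
        using that lin inv_H by (auto simp: U_def)
      show "(\<lambda>x. M x + N x) \<in> U" if "M \<in> U" "N \<in> U" for M N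
        using that V f by (auto simp: U_def operator_space_def functional_add)
      show "(\<lambda>x. c *s M x) \<in> U" if "M \<in> U" for c M
        using that V f by (auto simp: U_def operator_space_def functional_scale)
    qed
    have mono: "nonzero_eigenvalues_on (span C) M \<subseteq> nonzero_eigenvalues_on W M" for M
      using H unfolding nonzero_eigenvalues_on_def by auto
    show ?thesis unfolding W_def[symmetric]
    proof (cases "\<forall>M\<in>V. (\<forall>h\<in>span C. M h = 0) \<longrightarrow> (\<forall>x\<in>W. M x = 0)")
      \<comment> \<open>Restriction to the hyperplane loses nothing here, so \<open>n\<close>
        conditions and the induction hypothesis with unchanged \<open>e\<close> suffice.\<close>
      case True
      have "separated_by (span C) U ((n choose 2) + e)"
      proof (rule Suc.IH[OF Suc.prems(1) C(1) card opU])
        fix M assume "M \<in> U"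
        then have "finite (nonzero_eigenvalues_on W M) \<and> card (nonzero_eigenvalues_on W M) \<le> e"
          using Suc.prems(5) by (simp add: U_def W_def)
        then show "finite (nonzero_eigenvalues_on (span C) M) \<and>
            card (nonzero_eigenvalues_on (span C) M) \<le> e"
          using mono[of M] finite_subset card_mono le_trans by meson
      qed
      then show "separated_by W V ((Suc n choose 2) + e)"
        by (rule separated_by_extend[OF C(1) card f]) (use True choose in \<open>auto simp: U_def\<close>)
    next
      case False
      then obtain E x where E: "E \<in> V" "\<forall>h\<in>span C. E h = 0" and "x \<in> W" "E x \<noteq> 0" by blast
      then have fE: "f (E w) \<noteq> 0" using vanish by blast
      have EW: "E w \<in> W" using inv E(1) w(1) by blast
      have "E w \<noteq> 0" using fE f functional_zero by auto
      \<comment> \<open>\<open>E w\<close> is an eigenvector of \<open>E\<close>, so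
        \<open>e\<close> cannot be 0. This unit pays for the additional condition
        \<open>f (M w) = 0\<close>.\<close>
      then have "f (E w) \<in> nonzero_eigenvalues_on W E"
        unfolding nonzero_eigenvalues_on_def using fE EW decomp[OF E EW] by auto
      then have e: "e = 1"
        using Suc.prems(5)[OF E(1)] Suc.prems(1) unfolding W_def[symmetric]
        by (cases "e = 0") auto
      define U' where "U' = {M \<in> U. f (M w) = 0}"
      have opU': "operator_space (span C) U'"
        using opU f unfolding operator_space_def U'_def
        by (auto simp: functional_add functional_scale)
      \<comment> \<open>\<open>x\<close> differs from \<open>f x *s w\<close> by a vector of the
        hyperplane, which \<open>M\<close> preserves; thus \<open>M\<close> maps all of
        \<open>W\<close> into the hyperplane.\<close>
      have fM: "f (M x) = 0" if M: "M \<in> U'" and x: "x \<in> W" for M x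
      proof -
        have "x - f x *s w \<in> W" using x w subW subspace_diff subspace_scale by blast
        then have "x - f x *s w \<in> span C"
          using H f w by (simp add: functional_diff functional_scale)
        then have "M (x - f x *s w) \<in> span C" using inv_H M by (simp add: U'_def)
        then have "f (M (x - f x *s w)) = 0" using H by simp
        then show ?thesis using M lin f
          by (simp add: U'_def U_def operator_diff operator_scale functional_diff functional_scale)
      qed
      have sep: "separated_by (span C) U' ((n choose 2) + 0)"
      proof (rule Suc.IH[OF _ C(1) card opU'])
        fix M assume M: "M \<in> U'"
        then have MV: "M \<in> V" by (simp add: U'_def U_def)
        have "nonzero_eigenvalues_on (span C) M = {}"
        proof (rule ccontr)
          assume "nonzero_eigenvalues_on (span C) M \<noteq> {}"
          then obtain a h where a: "a \<noteq> 0" and h: "h \<in> span C" "h \<noteq> 0" "M h = a *s h"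
            unfolding nonzero_eigenvalues_on_def by auto
          \<comment> \<open>On the hyperplane \<open>E\<close> is zero, so \<open>A\<close> keeps
            the eigenvalue \<open>a\<close> of \<open>M\<close>. On the quotient line
            \<open>M\<close> acts as 0 and \<open>E\<close> as \<open>f (E w)\<close>, so the
            coefficient makes \<open>A\<close> act as \<open>- a\<close>. These are two different
            nonzero eigenvalues, as 2 is nonzero.\<close>
          define A where "A = (\<lambda>x. M x + (- a / f (E w)) *s E x)"
          have "(\<lambda>x. (- a / f (E w)) *s E x) \<in> V"
            using V E(1) unfolding operator_space_def by blast
          then have A: "A \<in> V" using addV[OF MV] by (simp only: A_def)
          have "- a \<in> nonzero_eigenvalues_on W A"
          proof (rule eigenvalue_on_quotient_line[OF C(1,3,4) _ w(1) subW lin[OF A]])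
            show "span C \<subseteq> W" using H by auto
            show "- a \<noteq> 0" using a by simp
            fix x assume x: "x \<in> W"
            have "f (A x - (- a) *s x) = 0"
              using fM[OF M x] fE
              by (simp add: A_def functional_diff[OF f] functional_add[OF f] functional_scale[OF f]
                decomp[OF E x] del: scale_minus_left)
            moreover have "A x - (- a) *s x \<in> W"
              using inv[OF A x] x subW subspace_diff subspace_scale by blast
            ultimately show "A x - (- a) *s x \<in> span C" using H by simp
          qed
          moreover have "a \<in> nonzero_eigenvalues_on W A"
            unfolding nonzero_eigenvalues_on_def using a h E(2) H by (auto simp: A_def)
          ultimately have "a = - a" using spec A by blast
          then have "2 * a = 0" by (metis add.right_inverse mult_2)
          then show False using two a by simp
        qed
        then show "finite (nonzero_eigenvalues_on (span C) M) \<and>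
            card (nonzero_eigenvalues_on (span C) M) \<le> 0" by simp
      qed simp
      show "separated_by W V ((Suc n choose 2) + e)"
      proof (rule separated_by_extend[of "insert w C" "Suc n", OF _ _ f sep])
        show "finite (insert w C)" "card (insert w C) \<le> Suc n" using C(1,4) card by simp_all
        show "(n choose 2) + 0 + Suc n \<le> (Suc n choose 2) + e" using choose e by simp
        show "M \<in> U'" if "M \<in> V" "\<forall>c\<in>insert w C. f (M c) = 0" for M
          using that by (simp add: U'_def U_def)
        show "\<forall>x\<in>W. M x = 0" if "M \<in> V" "M \<in> U'" "\<forall>h\<in>span C. M h = 0" for M
        proof (rule ccontr)
          assume "\<not> (\<forall>x\<in>W. M x = 0)"
          then obtain x where "x \<in> W" "M x \<noteq> 0" by blast
          then have "f (M w) \<noteq> 0" by (rule vanish[OF that(1,3)])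
          then show False using that(2) by (simp add: U'_def)
        qed
      qed
    qed
  qed
qed

end

section \<open>Dimension bounds from injective linear maps\<close>

text \<open>\<open>V\<close> gets a finite basis here: \<open>T\<close> maps independent sets to
  independent sets, so their sizes are bounded by \<open>W.dim\<close>, and a maximal independent
  set exists and is a basis.\<close>

lemma (in linear_map) dim_le_of_inj:
  assumes inj: "inj_on T (carrier V)" and fin: "W.fin_dim"
  shows "V.dim \<le> W.dim"
proof -
  have bound: "finite A \<and> card A \<le> W.dim" if A: "A \<subseteq> carrier V" "V.module.lin_indpt A" for A
  proof -
    have "W.module.lin_indpt (T ` A)"
    proof
      assume "W.module.lin_dep (T ` A)"
      then obtain S a x where S: "finite S" "S \<subseteq> T ` A" "a \<in> S \<rightarrow> carrier K"
        "W.module.lincomb a S = \<zero>\<^bsub>W\<^esub>" "x \<in> S" "a x \<noteq> \<zero>\<^bsub>K\<^esub>"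
        unfolding W.module.lin_dep_def by blast
      obtain A' where A': "A' \<subseteq> A" "finite A'" "S = T ` A'"
        using finite_subset_image[OF S(1,2)] by blast
      have cl: "V.module.lincomb (a \<circ> T) A' \<in> carrier V"
        using A A' S(3) by (intro V.module.lincomb_closed) auto
      have "T (V.module.lincomb (a \<circ> T) A') = T \<zero>\<^bsub>V\<^esub>"
        using lincomb_linear_image[OF inj _ _ A'(2), of a] A A' S(3,4) by auto
      then have "V.module.lincomb (a \<circ> T) A' = \<zero>\<^bsub>V\<^esub>" by (rule inj_onD[OF inj _ cl]) simp
      moreover obtain v where "v \<in> A'" "x = T v" using S(5) A'(3) by blast
      ultimately have "V.module.lin_dep A"
        unfolding V.module.lin_dep_def using A'(1,2) S(3,6) A'(3)
        by (intro exI[of _ A'] exI[of _ "a \<circ> T"] exI[of _ v]) auto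
      then show False using A(2) by simp
    qed
    moreover have "T ` A \<subseteq> carrier W" using A(1) by auto
    ultimately have "finite (T ` A)" "card (T ` A) \<le> W.dim"
      using W.li_le_dim[OF fin] by blast+
    moreover have "inj_on T A" using inj A(1) by (rule inj_on_subset)
    ultimately show ?thesis by (simp add: finite_image_iff card_image)
  qed
  have "{} \<subseteq> carrier V \<and> V.module.lin_indpt {}" by (simp add: V.module.lin_dep_def)
  then obtain A where A: "finite A" "maximal A (\<lambda>S. S \<subseteq> carrier V \<and> V.module.lin_indpt S)"
    using maximal_exists[of "\<lambda>S. S \<subseteq> carrier V \<and> V.module.lin_indpt S" W.dim "{}"] bound by blast
  then have "V.dim = card A" by (intro V.dim_basis V.max_li_is_basis)
  moreover have "card A \<le> W.dim" using A(2) bound unfolding maximal_def by blast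
  ultimately show ?thesis by simp
qed

text \<open>The functionals, listed in some order, are the coordinates of an injective linear map
  from \<open>V\<close> to vectors of length \<open>card \<Phi>\<close>.\<close>

lemma dim_le_card_separating_functionals:
  fixes V :: "'a :: field mat set"
  assumes V: "VectorSpace.subspace (class_ring :: 'a ring) V (module_mat TYPE('a) nr nc)"
    and fin: "finite \<Phi>"
    and add: "\<And>\<phi> M N. \<phi> \<in> \<Phi> \<Longrightarrow> M \<in> V \<Longrightarrow> N \<in> V \<Longrightarrow> \<phi> (M + N) = \<phi> M + \<phi> N"
    and smult: "\<And>\<phi> c M. \<phi> \<in> \<Phi> \<Longrightarrow> M \<in> V \<Longrightarrow> \<phi> (c \<cdot>\<^sub>m M) = c * \<phi> M"
    and sep: "\<And>M. M \<in> V \<Longrightarrow> \<forall>\<phi>\<in>\<Phi>. \<phi> M = 0 \<Longrightarrow> M = 0\<^sub>m nr nc"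
  shows "vectorspace.dim (class_ring :: 'a ring) ((module_mat TYPE('a) nr nc)\<lparr>carrier := V\<rparr>) \<le> card \<Phi>"
proof -
  interpret MV: vectorspace "class_ring :: 'a ring" "module_mat TYPE('a) nr nc"
    by (rule matrix_vs)
  interpret VS: vectorspace "class_ring :: 'a ring" "(module_mat TYPE('a) nr nc)\<lparr>carrier := V\<rparr>"
    by (rule MV.subspace_is_vs[OF V])
  define d where "d = card \<Phi>"
  interpret WS: vectorspace "class_ring :: 'a ring" "module_vec TYPE('a) d" by (rule vec_vs)
  obtain xs where xs: "set xs = \<Phi>" "distinct xs" using fin finite_distinct_list by blast
  then have len: "length xs = d" using distinct_card[of xs] by (simp add: d_def)
  define T where "T M = vec d (\<lambda>i. (xs ! i) M)" for M :: "'a mat"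
  have in_\<Phi>: "xs ! i \<in> \<Phi>" if "i < d" for i using that xs(1) len by auto
  have hom: "T \<in> LinearCombinations.module_hom class_ring ((module_mat TYPE('a) nr nc)\<lparr>carrier := V\<rparr>) (module_vec TYPE('a) d)"
    unfolding LinearCombinations.module_hom_def
    by (auto simp: module_mat_def module_vec_def T_def add smult in_\<Phi>)
  interpret L: linear_map "class_ring :: 'a ring" "(module_mat TYPE('a) nr nc)\<lparr>carrier := V\<rparr>"
    "module_vec TYPE('a) d" T
    by unfold_locales (rule hom)
  have ker: "M = 0\<^sub>m nr nc" if M: "M \<in> V" "T M = 0\<^sub>v d" for M
  proof (rule sep[OF M(1)], intro ballI)
    fix \<phi> assume "\<phi> \<in> \<Phi>"
    then obtain i where "i < d" "\<phi> = xs ! i" using xs(1) len by (metis in_set_conv_nth)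
    then show "\<phi> M = 0" using arg_cong[OF M(2), of "\<lambda>v. v $ i"] by (simp add: T_def)
  qed
  have "L.ker \<subseteq> {0\<^sub>m nr nc}"
    unfolding L.ker_def using ker by (fastforce simp: module_mat_def module_vec_def)
  moreover have "0\<^sub>m nr nc \<in> L.ker"
    unfolding L.ker_def using L.T0_is_0 VS.M.zero_closed by (simp add: module_mat_def module_vec_def)
  ultimately have "L.ker = {0\<^sub>m nr nc}" by blast
  then have "inj_on T V" using L.Ke0_imp_inj by (simp add: module_mat_def)
  then have "VS.dim \<le> WS.dim" using L.dim_le_of_inj vec_space.fin_dim[where 'a = 'a] by simp
  then show ?thesis using vec_space.dim_is_n[of d, where 'a = 'a] by (simp add: d_def)
qed

section \<open>Square matrices as operators on functions\<close>

text \<open>Vectors of length \<open>n\<close> are modelled as functions vanishing from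
  \<open>n\<close> on, a subspace of a whole type that is a group, as the locale requires. The value
  0 from \<open>n\<close> on keeps the image in that subspace.\<close>

definition mat_operator :: "nat \<Rightarrow> 'a :: field mat \<Rightarrow> (nat \<Rightarrow> 'a) \<Rightarrow> nat \<Rightarrow> 'a" where
  "mat_operator n M v = (\<lambda>i. if i < n then \<Sum>j<n. M $$ (i, j) * v j else 0)"

definition unit_fun :: "nat \<Rightarrow> nat \<Rightarrow> 'a :: field" where
  "unit_fun i = (\<lambda>j. if j = i then 1 else 0)"

interpretation fun_space: operator_vector_space "\<lambda>(c :: 'a :: field) (v :: nat \<Rightarrow> 'a) i. c * v i"
  by unfold_locales (auto simp: algebra_simps)

lemma span_unit_fun:
  "fun_space.span (unit_fun ` {..<n}) = {v :: nat \<Rightarrow> 'a :: field. \<forall>i\<ge>n. v i = 0}"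
proof
  show "fun_space.span (unit_fun ` {..<n}) \<subseteq> {v :: nat \<Rightarrow> 'a. \<forall>i\<ge>n. v i = 0}"
    by (rule fun_space.span_minimal) (auto simp: unit_fun_def intro!: fun_space.subspaceI)
  show "{v :: nat \<Rightarrow> 'a. \<forall>i\<ge>n. v i = 0} \<subseteq> fun_space.span (unit_fun ` {..<n})"
  proof (induction n)
    case 0
    have "v = 0" if "\<forall>i\<ge>0. v i = 0" for v :: "nat \<Rightarrow> 'a" using that by auto
    then show ?case by (auto simp: fun_space.span_zero)
  next
    case (Suc n)
    show ?case
    proof
      fix v :: "nat \<Rightarrow> 'a" assume "v \<in> {v. \<forall>i\<ge>Suc n. v i = 0}"
      then have v: "\<And>i. i \<ge> Suc n \<Longrightarrow> v i = 0" by simp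
      let ?S = "fun_space.span (unit_fun ` {..<Suc n}) :: (nat \<Rightarrow> 'a) set"
      have "(v(n := 0)) i = 0" if "i \<ge> n" for i using v that by (cases "i = n") auto
      then have "v(n := 0) \<in> fun_space.span (unit_fun ` {..<n})" using Suc.IH by blast
      moreover have "unit_fun ` {..<n} \<subseteq> unit_fun ` {..<Suc n}" by auto
      ultimately have "v(n := 0) \<in> ?S" using fun_space.span_mono by blast
      moreover have "(\<lambda>i. v n * unit_fun n i) \<in> ?S"
        by (rule fun_space.span_scale[OF fun_space.span_base]) simp
      ultimately have "v(n := 0) + (\<lambda>i. v n * unit_fun n i) \<in> ?S" by (rule fun_space.span_add)
      also have "v(n := 0) + (\<lambda>i. v n * unit_fun n i) = v" by (auto simp: unit_fun_def)
      finally show "v \<in> ?S" .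
    qed
  qed
qed

lemma linear_mat_operator:
  "Vector_Spaces.linear (\<lambda>c v i. c * v i) (\<lambda>c v i. c * v i) (mat_operator n M)"
  unfolding Vector_Spaces.linear_iff
  using fun_space.vector_space_axioms
  by (auto simp: mat_operator_def fun_eq_iff algebra_simps sum.distrib sum_distrib_left)

lemma mat_operator_add:
  assumes "M \<in> carrier_mat n n" "N \<in> carrier_mat n n"
  shows "mat_operator n (M + N) = (\<lambda>v. mat_operator n M v + mat_operator n N v)"
  using assms by (auto simp: mat_operator_def fun_eq_iff algebra_simps sum.distrib)

lemma mat_operator_smult:
  assumes "M \<in> carrier_mat n n"
  shows "mat_operator n (c \<cdot>\<^sub>m M) = (\<lambda>v i. c * mat_operator n M v i)"
  using assms by (auto simp: mat_operator_def fun_eq_iff algebra_simps sum_distrib_left)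

lemma mat_operator_unit_fun:
  assumes "i < n" "j < n"
  shows "mat_operator n M (unit_fun j) i = M $$ (i, j)"
  using assms by (simp add: mat_operator_def unit_fun_def if_distrib[of "(*) _"] cong: if_cong)

text \<open>An eigenvector in this span vanishes from \<open>n\<close> on, so its first
  \<open>n\<close> entries form a nonzero vector, an eigenvector of \<open>M\<close> for the same
  \<open>a\<close>.\<close>

lemma nonzero_eigenvalues_on_mat_operator:
  fixes M :: "'a :: field mat"
  assumes M: "M \<in> carrier_mat n n"
  shows "fun_space.nonzero_eigenvalues_on (fun_space.span (unit_fun ` {..<n})) (mat_operator n M)
    \<subseteq> nonzero_spectrum M"
proof
  fix a assume "a \<in> fun_space.nonzero_eigenvalues_on (fun_space.span (unit_fun ` {..<n})) (mat_operator n M)"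
  then obtain v where a: "a \<noteq> 0" and v: "\<forall>i\<ge>n. v i = 0" "v \<noteq> 0"
    and ev: "mat_operator n M v = (\<lambda>i. a * v i)"
    unfolding fun_space.nonzero_eigenvalues_on_def span_unit_fun by blast
  have "M *\<^sub>v vec n v = a \<cdot>\<^sub>v vec n v"
  proof (rule eq_vecI)
    fix i assume "i < dim_vec (a \<cdot>\<^sub>v vec n v)"
    then show "(M *\<^sub>v vec n v) $ i = (a \<cdot>\<^sub>v vec n v) $ i"
      using M fun_cong[OF ev, of i]
      by (simp add: mat_operator_def scalar_prod_def atLeast0LessThan)
  qed (use M in simp)
  moreover have "vec n v \<noteq> 0\<^sub>v n"
  proof
    assume z: "vec n v = 0\<^sub>v n"
    have "v i = 0" for i
      using v(1) arg_cong[OF z, of "\<lambda>u. u $ i"] by (cases "i < n") auto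
    then show False using v(2) by auto
  qed
  ultimately have "eigenvalue M a" using M
    unfolding eigenvalue_def eigenvector_def by (intro exI[of _ "vec n v"]) auto
  then show "a \<in> nonzero_spectrum M" using a by (simp add: nonzero_spectrum_def)
qed

section \<open>Transfer of the bound from operators to matrices\<close>

theorem mainTheorem2:
  fixes V :: "'a :: field mat set" and n :: nat
  assumes "CHAR('a) \<noteq> 2"
    and "n \<ge> 1"
    and "VectorSpace.subspace (class_ring :: 'a ring) V (module_mat TYPE('a) n n)"
    and "\<forall>M\<in>V. finite (nonzero_spectrum M) \<and> card (nonzero_spectrum M) \<le> 1"
  shows "vectorspace.dim (class_ring :: 'a ring) ((module_mat TYPE('a) n n)\<lparr>carrier := V\<rparr>)
           \<le> (n choose 2) + 1"
proof -
  have sub: "submodule (class_ring :: 'a ring) V (module_mat TYPE('a) n n)"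
    using assms(3) by (simp add: VectorSpace.subspace_def)
  have car: "V \<subseteq> carrier_mat n n"
    using submodule.subset[OF sub] by (simp add: module_mat_def)
  have add: "M + N \<in> V" if "M \<in> V" "N \<in> V" for M N
    using submodule.m_closed[OF sub that] by (simp add: module_mat_def)
  have smult: "c \<cdot>\<^sub>m M \<in> V" if "M \<in> V" for c M
    using submodule.smult_closed[OF sub _ that, of c] by (simp add: module_mat_def)
  let ?B = "unit_fun ` {..<n} :: (nat \<Rightarrow> 'a) set"
  let ?W = "fun_space.span ?B"
  have "(2 :: 'a) \<noteq> 0"
  proof
    assume "(2 :: 'a) = 0"
    then have "of_nat 2 = (0 :: 'a)" by simp
    then have "CHAR('a) dvd 2" using of_nat_eq_0_iff_char_dvd by blast
    then have "CHAR('a) = 1 \<or> CHAR('a) = 2" using two_is_prime_nat unfolding prime_nat_iff by blast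
    then show False using assms(1) by simp
  qed
  then have "fun_space.separated_by ?W (mat_operator n ` V) ((n choose 2) + 1)"
  proof (rule fun_space.few_eigenvalues_separated_by)
    show "card ?B \<le> n" using card_image_le[of "{..<n}" unit_fun] by simp
    show "fun_space.operator_space ?W (mat_operator n ` V)"
      unfolding fun_space.operator_space_def
    proof (intro conjI ballI allI)
      fix F assume "F \<in> mat_operator n ` V"
      then obtain M where M: "F = mat_operator n M" "M \<in> V" by blast
      then show "Vector_Spaces.linear (\<lambda>c v i. c * v i) (\<lambda>c v i. c * v i) F"
        by (simp add: linear_mat_operator)
      show "F ` ?W \<subseteq> ?W" using M by (auto simp: span_unit_fun mat_operator_def)
      show "(\<lambda>v i. c * F v i) \<in> mat_operator n ` V" for c
        using M(2) car smult by (intro image_eqI[of _ _ "c \<cdot>\<^sub>m M"]) (auto simp: M(1) mat_operator_smult)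
      fix G assume "G \<in> mat_operator n ` V"
      then obtain N where N: "G = mat_operator n N" "N \<in> V" by blast
      have "M \<in> carrier_mat n n" "N \<in> carrier_mat n n" using M(2) N(2) car by auto
      then have "(\<lambda>v. F v + G v) = mat_operator n (M + N)"
        by (simp add: M(1) N(1) mat_operator_add)
      then show "(\<lambda>v. F v + G v) \<in> mat_operator n ` V" using add[OF M(2) N(2)] by blast
    qed
    fix F assume "F \<in> mat_operator n ` V"
    then obtain M where M: "F = mat_operator n M" "M \<in> V" by blast
    then have "fun_space.nonzero_eigenvalues_on ?W F \<subseteq> nonzero_spectrum M"
      using nonzero_eigenvalues_on_mat_operator car by blast
    moreover have "finite (nonzero_spectrum M)" "card (nonzero_spectrum M) \<le> 1"
      using assms(4) M(2) by auto
    ultimately have "finite (fun_space.nonzero_eigenvalues_on ?W F)"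
      "card (fun_space.nonzero_eigenvalues_on ?W F) \<le> 1"
      by (auto intro: finite_subset le_trans[OF card_mono])
    then show "finite (fun_space.nonzero_eigenvalues_on ?W F) \<and>
        card (fun_space.nonzero_eigenvalues_on ?W F) \<le> 1" by blast
  qed simp_all
  then obtain \<Phi> where \<Phi>: "finite \<Phi>" "card \<Phi> \<le> (n choose 2) + 1"
    "\<forall>(f, h)\<in>\<Phi>. Vector_Spaces.linear (\<lambda>c v i. c * v i) (*) f"
    "\<forall>F\<in>mat_operator n ` V. (\<forall>(f, h)\<in>\<Phi>. f (F h) = 0) \<longrightarrow> (\<forall>w\<in>?W. F w = 0)"
    unfolding fun_space.separated_by_def by blast
  \<comment> \<open>Evaluation at \<open>h\<close> followed by \<open>f\<close> turns each pair into
    a scalar functional on matrices, linear on \<open>V\<close>. Distinct pairs may give the same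
    functional, hence only an inequality between the cardinalities.\<close>
  let ?\<Psi> = "(\<lambda>(f, h) M. f (mat_operator n M h)) ` \<Phi>"
  have "vectorspace.dim (class_ring :: 'a ring) ((module_mat TYPE('a) n n)\<lparr>carrier := V\<rparr>) \<le> card ?\<Psi>"
  proof (rule dim_le_card_separating_functionals[OF assms(3)])
    show "finite ?\<Psi>" using \<Phi>(1) by simp
    fix \<phi> assume "\<phi> \<in> ?\<Psi>"
    then obtain f h where \<phi>: "\<phi> = (\<lambda>M. f (mat_operator n M h))"
      and f: "Vector_Spaces.linear (\<lambda>c v i. c * v i) (*) f"
      using \<Phi>(3) by auto
    show "\<phi> (M + N) = \<phi> M + \<phi> N" if "M \<in> V" "N \<in> V" for M N
      using that car mat_operator_add[of M n N] fun_space.functional_add[OF f]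
      by (simp add: \<phi> subset_eq)
    show "\<phi> (c \<cdot>\<^sub>m M) = c * \<phi> M" if "M \<in> V" for c M
      using that car mat_operator_smult[of M n c] fun_space.functional_scale[OF f]
      by (simp add: \<phi> subset_eq)
  next
    fix M assume M: "M \<in> V" "\<forall>\<phi>\<in>?\<Psi>. \<phi> M = 0"
    then have zero: "\<forall>w\<in>?W. mat_operator n M w = 0" using \<Phi>(4) by fastforce
    show "M = 0\<^sub>m n n"
    proof (rule eq_matI)
      fix i j assume "i < dim_row (0\<^sub>m n n)" "j < dim_col (0\<^sub>m n n)"
      then have ij: "i < n" "j < n" by simp_all
      \<comment> \<open>The operator applied to \<open>unit_fun j\<close> exhibits column
        \<open>j\<close> of \<open>M\<close>.\<close>
      have "unit_fun j \<in> ?W" using ij(2) by (intro fun_space.span_base) simp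
      then have "mat_operator n M (unit_fun j) i = 0" using zero by simp
      then show "M $$ (i, j) = 0\<^sub>m n n $$ (i, j)" using ij by (simp add: mat_operator_unit_fun)
    qed (use M(1) car in auto)
  qed
  also have "card ?\<Psi> \<le> card \<Phi>" using \<Phi>(1) by (rule card_image_le)
  finally show ?thesis using \<Phi>(2) by linarith
qed

end
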